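(* Let $\mathcal{P}=\{T_k(x)\}_{k=0}^\infty$, where $T_k$ is the $k$-th Chebyshev polynomial of the first kind. Then $$\mathscr{T}_k^{(n)}(\mathcal{P};x)=\frac{2^{2n-1}}{(2n)!}(1-x^2)^n$$ for all integers $n\ge 1$ and all $k\in\mathbb{N}$.
   Context: $\mathbb{N}=\{0,1,2,\dots\}$. For a sequence of polynomials $\mathcal{P}=\{P_k(x)\}_{k=0}^\infty$, the $k$-th extended Turán expression (of order $n$) is $$\mathscr{T}_k^{(n)}(\mathcal{P};x)=\sum_{j=0}^{2n}\frac{(-1)^{n+j}}{(2n)!}\binom{2n}{j}P_{j+k}(x)P_{2n+k-j}(x).$$ The Chebyshev polynomials of the first kind are the standard ones, with $T_k(\cos\theta)=\cos(k\theta)$. *)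

theory Defs
  imports Complex_Main "HOL-Computational_Algebra.Polynomial"
begin

fun chebyshev_T :: "nat \<Rightarrow> real poly" where
  "chebyshev_T 0 = 1"
| "chebyshev_T (Suc 0) = [:0, 1:]"
| "chebyshev_T (Suc (Suc k)) = [:0, 2:] * chebyshev_T (Suc k) - chebyshev_T k"

(* The recurrence agrees with the description T_k(cos t) = cos (k t), which determines T_k. *)

lemma poly_chebyshev_T_cos: "poly (chebyshev_T k) (cos t) = cos (real k * t)"
proof (induction k rule: chebyshev_T.induct)
  case (3 k)
  have "cos (real (Suc (Suc k)) * t) + cos (real k * t)
      = cos (real (Suc k) * t + t) + cos (real (Suc k) * t - t)"
    by (simp add: algebra_simps)
  also have "\<dots> = 2 * cos t * cos (real (Suc k) * t)"
    by (simp only: cos_add cos_diff) simp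
  finally show ?case
    using 3 by simp
qed simp_all

lemma chebyshev_T_unique:
  assumes "\<And>t. poly p (cos t) = cos (real k * t)"
  shows "p = chebyshev_T k"
proof (rule ccontr)
  assume "p \<noteq> chebyshev_T k"
  then have "finite {x. poly (p - chebyshev_T k) x = 0}"
    by (intro poly_roots_finite) simp
  moreover have "{-1..1} \<subseteq> {x. poly (p - chebyshev_T k) x = 0}"
  proof
    fix x :: real
    assume "x \<in> {-1..1}"
    then have "x = cos (arccos x)"
      by simp
    then show "x \<in> {x. poly (p - chebyshev_T k) x = 0}"
      using assms[of "arccos x"] poly_chebyshev_T_cos[of k "arccos x"] by simp
  qed
  ultimately have "finite {-1..1::real}"
    by (rule rev_finite_subset)
  then show False
    using infinite_Icc[of "-1::real" 1] by simp
qed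

(* The extended Turan expression as a polynomial in x. In the last index the
   natural-number subtraction never truncates, since j \<le> 2 * n. *)
definition extended_Turan :: "nat \<Rightarrow> nat \<Rightarrow> (nat \<Rightarrow> real poly) \<Rightarrow> real poly" where
  "extended_Turan n k P =
     (\<Sum>j=0..2*n. smult ((-1) ^ (n + j) / fact (2*n) * real ((2*n) choose j))
                    (P (j + k) * P (2*n + k - j)))"

end

(* Put x = cos t. The product-to-sum formula turns the product of the two Chebyshev values
   into (cos (2(n+k)t) + cos (2(j-n)t)) / 2. The first cosine does not depend on j, so its
   alternating binomial sum vanishes. The second contributes the real part of the binomial
   expansion of (exp(-it) - exp(it))^(2n) = (-2i sin t)^(2n). *)
theory Submission
  imports Defs
begin

text \<open>Since cos maps onto [-1, 1], the difference of the two polynomials would have infinitely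
  many roots. This lets the theorem be checked pointwise in t.\<close>

lemma poly_eqI_cos:
  fixes p q :: "real poly"
  assumes "\<And>t. poly p (cos t) = poly q (cos t)"
  shows "p = q"
proof (rule ccontr)
  assume "p \<noteq> q"
  then have "finite {x. poly (p - q) x = 0}"
    by (intro poly_roots_finite) simp
  moreover have "{-1..1} \<subseteq> {x. poly (p - q) x = 0}"
  proof
    fix x :: real
    assume "x \<in> {-1..1}"
    then show "x \<in> {x. poly (p - q) x = 0}"
      using assms[of "arccos x"] by simp
  qed
  ultimately have "finite {-1..1::real}"
    by (rule rev_finite_subset)
  then show False
    using infinite_Icc[of "-1::real" 1] by simp
qed

lemma alternating_binomial_cos_sum:
  "(\<Sum>j\<le>2*n. (-1) ^ (n + j) * real ((2*n) choose j) * cos ((2 * real j - 2 * real n) * t))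
     = 4 ^ n * sin t ^ (2*n)"
proof -
  have "(cis (-t) - cis t) ^ (2*n)
      = (\<Sum>j\<le>2*n. of_nat ((2*n) choose j) * (- cis t) ^ j * cis (-t) ^ (2*n - j))"
    using binomial_ring[of "- cis t" "cis (-t)" "2*n"] by simp
  also have "\<dots> = (\<Sum>j\<le>2*n. of_real ((-1) ^ j * real ((2*n) choose j))
                              * cis ((2 * real j - 2 * real n) * t))"
  proof (intro sum.cong refl)
    fix j assume "j \<in> {..2*n}"
    \<comment> \<open>The angle of a product of j factors \<open>cis t\<close> and 2n - j factors
      \<open>cis (-t)\<close>; the bound on j keeps the natural subtraction exact.\<close>
    then have "real j * t + real (2*n - j) * (-t) = (2 * real j - 2 * real n) * t"
      by (simp add: of_nat_diff algebra_simps)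
    then have "cis t ^ j * cis (-t) ^ (2*n - j) = cis ((2 * real j - 2 * real n) * t)"
      by (simp only: DeMoivre cis_mult)
    then show "of_nat ((2*n) choose j) * (- cis t) ^ j * cis (-t) ^ (2*n - j)
        = of_real ((-1) ^ j * real ((2*n) choose j)) * cis ((2 * real j - 2 * real n) * t)"
      by (simp add: power_minus[of "cis t"] mult.assoc)
  qed
  finally have expansion: "(cis (-t) - cis t) ^ (2*n) = \<dots>" .
  \<comment> \<open>The cosines cancel and the sines add up. The square of this imaginary number is
    real, so the even power 2n is real as well.\<close>
  have "cis (-t) - cis t = - 2 * \<i> * of_real (sin t)"
    by (simp add: complex_eq_iff)
  then have "(cis (-t) - cis t)\<^sup>2 = of_real ((-4) * (sin t)\<^sup>2)"
    by (simp add: power_mult_distrib)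
  then have "(cis (-t) - cis t) ^ (2*n) = of_real ((-4) ^ n * sin t ^ (2*n))"
    by (simp only: power_mult power_mult_distrib of_real_mult of_real_power)
  with expansion have "(\<Sum>j\<le>2*n. of_real ((-1) ^ j * real ((2*n) choose j))
      * cis ((2 * real j - 2 * real n) * t)) = of_real ((-4) ^ n * sin t ^ (2*n))"
    by simp
  \<comment> \<open>Read as scalar multiplications, the real coefficients pass through
    \<open>Re\<close>, which turns each \<open>cis\<close> into a cosine.\<close>
  from arg_cong[OF this, of Re]
  have "(\<Sum>j\<le>2*n. (-1) ^ j * real ((2*n) choose j) * cos ((2 * real j - 2 * real n) * t))
      = (-4) ^ n * sin t ^ (2*n)"
    by (simp only: Re_sum Re_complex_of_real cis.sel scaleR_complex.sel real_scaleR_def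
        flip: scaleR_conv_of_real)
  \<comment> \<open>The factor (-1)^n cancels the sign of (-4)^n and merges with (-1)^j into (-1)^(n
    + j).\<close>
  then have "(-1) ^ n * (\<Sum>j\<le>2*n. (-1) ^ j * real ((2*n) choose j)
      * cos ((2 * real j - 2 * real n) * t)) = ((-1) * (-4)) ^ n * sin t ^ (2*n)"
    by (simp only: power_mult_distrib mult.assoc)
  then show ?thesis
    by (simp add: sum_distrib_left power_add mult.assoc)
qed

theorem proposition4p1:
  fixes n k :: nat
  assumes "n \<ge> 1"
  shows "extended_Turan n k chebyshev_T
           = smult (2 ^ (2*n - 1) / fact (2*n)) ([:1, 0, -1:] ^ n)"
proof (rule poly_eqI_cos)
  fix t :: real
  define c where "c = cos (2 * real (n + k) * t)"
  have product: "cos (real (j + k) * t) * cos (real (2*n + k - j) * t)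
      = (c + cos ((2 * real j - 2 * real n) * t)) / 2" if "j \<le> 2*n" for j
  proof -
    \<comment> \<open>The indices j + k and 2n + k - j have a sum free of j and a difference free of
      k.\<close>
    have "real (j + k) * t + real (2*n + k - j) * t = 2 * real (n + k) * t"
      and "real (j + k) * t - real (2*n + k - j) * t = (2 * real j - 2 * real n) * t"
      using that by (simp_all add: of_nat_diff algebra_simps)
    then show ?thesis
      by (simp only: cos_times_cos c_def add.commute)
  qed
  have "poly (extended_Turan n k chebyshev_T) (cos t)
      = (\<Sum>j\<le>2*n. (-1) ^ (n + j) / fact (2*n) * real ((2*n) choose j)
                   * ((c + cos ((2 * real j - 2 * real n) * t)) / 2))"
    unfolding extended_Turan_def poly_sum atLeast0AtMost
    by (intro sum.cong refl) (simp only: poly_smult poly_mult poly_chebyshev_T_cos atMost_iff product)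
  also have "\<dots> = ((-1) ^ n * c * (\<Sum>j\<le>2*n. (-1) ^ j * real ((2*n) choose j))
      + (\<Sum>j\<le>2*n. (-1) ^ (n + j) * real ((2*n) choose j)
                   * cos ((2 * real j - 2 * real n) * t))) / (2 * fact (2*n))"
    unfolding sum_distrib_left sum.distrib[symmetric] sum_divide_distrib
    by (intro sum.cong refl) (simp add: power_add field_simps)
  \<comment> \<open>Here n \<ge> 1 matters: the alternating sum of the binomial coefficients of 2n
    is 0 only for 2n > 0.\<close>
  also have "\<dots> = 4 ^ n * sin t ^ (2*n) / (2 * fact (2*n))"
    using assms choose_alternating_sum[of "2*n", where 'a = real]
    by (simp only: alternating_binomial_cos_sum) simp
  also have "\<dots> = 2 ^ (2*n - 1) / fact (2*n) * (1 - cos t ^ 2) ^ n"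
  proof -
    \<comment> \<open>One factor 2 of 4^n cancels the 2 left in the denominator by the
      product-to-sum formula; n \<ge> 1 keeps the exponent 2n - 1 from truncating.\<close>
    have "(4::real) ^ n = 2 * 2 ^ (2*n - 1)"
      using assms by (simp add: power_mult flip: power_Suc)
    then show ?thesis
      by (simp add: power_mult sin_squared_eq)
  qed
  also have "\<dots> = poly (smult (2 ^ (2*n - 1) / fact (2*n)) ([:1, 0, -1:] ^ n)) (cos t)"
    by (simp add: power2_eq_square)
  finally show "poly (extended_Turan n k chebyshev_T) (cos t) = \<dots>" .
qed

end
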